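(* Suppose that $$A=\begin{bmatrix} B & C\\ 0 & D\end{bmatrix},$$ where $B\in\mathbb{R}^{n\times n}$, $C\in\mathbb{R}^{n\times m}$, $D\in\mathbb{R}^{m\times m}$, and $0$ denotes the $m\times n$ zero matrix. Then $A$ is an EP-matrix if and only if both $B$ and $D$ are EP-matrices.
   Context: A square real matrix is called a P-matrix if all its principal minors are positive. A square real matrix $A$ is called an EP-matrix (exponential P-matrix) if $\exp(At)$ is a P-matrix for all $t\ge 0$. *)

theory Defs
  imports
    Complex_Main
    "Jordan_Normal_Form.Determinant"
    "Jordan_Normal_Form.DL_Submatrix"
begin

definition P_matrix :: "real mat \<Rightarrow> bool" where
  "P_matrix A \<longleftrightarrow> square_mat A \<and>
     (\<forall>I. I \<noteq> {} \<longrightarrow> I \<subseteq> {..<dim_row A} \<longrightarrow> det (submatrix A I I) > 0)"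

text \<open>The power series of the exponential, summed entry by entry since \<^typ>\<open>real mat\<close> carries no
  topology. It is meaningful for square matrices only; convergence is the lemma below.\<close>

definition mat_exp :: "real mat \<Rightarrow> real mat" where
  "mat_exp A = mat (dim_row A) (dim_row A) (\<lambda>(i, j). \<Sum>k. (A ^\<^sub>m k) $$ (i, j) / fact k)"

definition EP_matrix :: "real mat \<Rightarrow> bool" where
  "EP_matrix A \<longleftrightarrow> square_mat A \<and> (\<forall>t\<ge>0. P_matrix (mat_exp (t \<cdot>\<^sub>m A)))"

lemma pow_mat_entry_bound:
  fixes A :: "real mat"
  assumes A: "A \<in> carrier_mat n n" and M: "\<And>i j. i < n \<Longrightarrow> j < n \<Longrightarrow> \<bar>A $$ (i, j)\<bar> \<le> M"
    and "i < n" "j < n"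
  shows "\<bar>(A ^\<^sub>m k) $$ (i, j)\<bar> \<le> (real n * M) ^ k"
  using assms(3,4)
proof (induction k arbitrary: j)
  case 0
  then show ?case using A by simp
next
  case (Suc k)
  have P: "A ^\<^sub>m k \<in> carrier_mat n n" using A by simp
  have "(A ^\<^sub>m Suc k) $$ (i, j) = (\<Sum>l = 0..<n. (A ^\<^sub>m k) $$ (i, l) * A $$ (l, j))"
    using A P Suc.prems by (simp add: scalar_prod_def)
  also have "\<bar>\<dots>\<bar> \<le> (\<Sum>l = 0..<n. \<bar>(A ^\<^sub>m k) $$ (i, l) * A $$ (l, j)\<bar>)"
    by (rule sum_abs)
  also have "\<dots> \<le> (\<Sum>l = 0..<n. (real n * M) ^ k * M)"
  proof (rule sum_mono)
    fix l assume l: "l \<in> {0..<n}"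
    have "\<bar>(A ^\<^sub>m k) $$ (i, l)\<bar> \<le> (real n * M) ^ k" using Suc.IH[of l] Suc.prems l by simp
    moreover have "\<bar>A $$ (l, j)\<bar> \<le> M" using M l Suc.prems by simp
    ultimately show "\<bar>(A ^\<^sub>m k) $$ (i, l) * A $$ (l, j)\<bar> \<le> (real n * M) ^ k * M"
      unfolding abs_mult by (intro mult_mono) auto
  qed
  finally show ?case by (simp add: mult_ac)
qed

lemma summable_mat_exp:
  fixes A :: "real mat"
  assumes A: "A \<in> carrier_mat n n" and "i < n" "j < n"
  shows "summable (\<lambda>k. (A ^\<^sub>m k) $$ (i, j) / fact k)"
proof -
  define M where "M = Max ((\<lambda>(i, j). \<bar>A $$ (i, j)\<bar>) ` ({..<n} \<times> {..<n}))"
  have M: "\<bar>A $$ (i, j)\<bar> \<le> M" if "i < n" "j < n" for i j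
    unfolding M_def using that by (intro Max_ge) auto
  have "summable (\<lambda>k. (real n * M) ^ k / fact k)"
    using summable_exp[of "real n * M"] by (simp add: field_simps)
  then show ?thesis
  proof (rule summable_comparison_test')
    fix k :: nat
    show "norm ((A ^\<^sub>m k) $$ (i, j) / fact k) \<le> (real n * M) ^ k / fact k"
      using pow_mat_entry_bound[OF A M assms(2,3), of k] by (simp add: divide_right_mono)
  qed
qed

end

theory Submission
  imports Defs
begin

text \<open>Powers of a block upper triangular matrix are again block upper triangular, so
  \<open>exp (At)\<close> has diagonal blocks \<open>exp (Bt)\<close> and \<open>exp (Dt)\<close> and lower left block \<open>0\<close>. A principal
  submatrix inherits this shape, and its determinant is the product of a principal minor of
  \<open>exp (Bt)\<close> and one of \<open>exp (Dt)\<close>, where an empty minor counts as \<open>1\<close>.\<close>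

lemma pick_Un_left:
  assumes I: "I \<subseteq> {..<n}" and i: "i < card I"
  shows "pick (I \<union> (+) n ` J) i = pick I i"
proof -
  have eq: "{a. a < n \<and> a \<in> I \<union> (+) n ` J} = I" using I by auto
  show ?thesis using pick_reduce_set[of i n "I \<union> (+) n ` J"] i unfolding eq by simp
qed

text \<open>\<open>pick\<close> inverts the rank function. Below \<open>n + pick J j\<close> lie all
  of \<open>I\<close> and the shifts of the j elements of \<open>J\<close> below
  \<open>pick J j\<close>, so its rank in the union is \<open>card I + j\<close>.\<close>

lemma pick_Un_right:
  assumes I: "I \<subseteq> {..<n}" and j: "j < card J"
  shows "pick (I \<union> (+) n ` J) (card I + j) = n + pick J j"
proof -
  let ?x = "n + pick J j"
  have J: "pick J j \<in> J" and cJ: "card {a \<in> J. a < pick J j} = j"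
    using j by (auto intro: pick_in_set_le card_pick_le)
  have fin: "finite I" using I finite_subset by blast
  have "{a \<in> I \<union> (+) n ` J. a < ?x} = I \<union> (+) n ` {a \<in> J. a < pick J j}"
    using I by fastforce
  moreover have "card \<dots> = card I + card ((+) n ` {a \<in> J. a < pick J j})"
    using I fin by (intro card_Un_disjoint) auto
  ultimately have "card {a \<in> I \<union> (+) n ` J. a < ?x} = card I + j"
    using cJ by (simp add: card_image)
  then show ?thesis using pick_card_in_set[of ?x "I \<union> (+) n ` J"] J by simp
qed

text \<open>\<open>submatrix\<close> first discards out-of-range indices; for index sets within
  range this filter is the identity.\<close>

lemma submatrix_carrier_subset:
  assumes "M \<in> carrier_mat n m" and "I \<subseteq> {..<n}" and "J \<subseteq> {..<m}"
  shows "submatrix M I J \<in> carrier_mat (card I) (card J)"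
proof -
  have "{i. i < n \<and> i \<in> I} = I" "{j. j < m \<and> j \<in> J} = J" using assms by auto
  then show ?thesis using assms(1) by (simp add: submatrix_def)
qed

lemma submatrix_index_subset:
  assumes "M \<in> carrier_mat n m" and "I \<subseteq> {..<n}" and "J \<subseteq> {..<m}" and "i < card I" and "j < card J"
  shows "submatrix M I J $$ (i, j) = M $$ (pick I i, pick J j)"
proof -
  have "{i. i < n \<and> i \<in> I} = I" "{j. j < m \<and> j \<in> J} = J" using assms by auto
  then show ?thesis using assms by (intro submatrix_index) auto
qed

text \<open>The index set lists \<open>I\<close> first and the shifted \<open>J\<close> after it, so
  selecting rows and columns never mixes the blocks.\<close>

lemma submatrix_four_block_mat:
  assumes B: "B \<in> carrier_mat n n" and X: "X \<in> carrier_mat n m" and D: "D \<in> carrier_mat m m"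
    and I: "I \<subseteq> {..<n}" and J: "J \<subseteq> {..<m}"
  shows "submatrix (four_block_mat B X (0\<^sub>m m n) D) (I \<union> (+) n ` J) (I \<union> (+) n ` J) =
    four_block_mat (submatrix B I I) (submatrix X I J) (0\<^sub>m (card J) (card I)) (submatrix D J J)"
    (is "submatrix ?M ?K ?K = ?N")
proof -
  have fin: "finite I" "finite J" using I J finite_subset by blast+
  have "card ?K = card I + card ((+) n ` J)"
    using I fin by (intro card_Un_disjoint) auto
  then have cK: "card ?K = card I + card J" by (simp add: card_image)
  have K: "?K \<subseteq> {..<n + m}" using I J by auto
  have M: "?M \<in> carrier_mat (n + m) (n + m)" using B D by simp
  have pI: "pick I i < n" if "i < card I" for i using I pick_in_set_le[OF that] by auto
  have pJ: "pick J j < m" if "j < card J" for j using J pick_in_set_le[OF that] by auto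
  note carr = submatrix_carrier_subset[OF B I I] submatrix_carrier_subset[OF D J J]
    submatrix_carrier_subset[OF X I J]
  have N: "?N \<in> carrier_mat (card I + card J) (card I + card J)" using carr by simp
  show ?thesis
  proof (rule eq_matI)
    fix i j assume "i < dim_row ?N" "j < dim_col ?N"
    then have ij: "i < card I + card J" "j < card I + card J" using N by auto
    \<comment> \<open>Locates a position of the submatrix in the first or second block. Used once
      for the row and once for the column, it gives the four blocks.\<close>
    have cases: "(l < card I \<and> pick ?K l = pick I l)
        \<or> (\<exists>l'. l = card I + l' \<and> l' < card J \<and> pick ?K l = n + pick J l')"
      if "l < card I + card J" for l
    proof (cases "l < card I")
      case True
      then show ?thesis using pick_Un_left[OF I] by simp
    next
      case False
      then have "l = card I + (l - card I)" "l - card I < card J" using that by auto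
      then show ?thesis using pick_Un_right[OF I] by metis
    qed
    have "?M $$ (pick ?K i, pick ?K j) = ?N $$ (i, j)"
      using cases[OF ij(1)]
    proof (elim disjE exE conjE)
      assume i: "i < card I" "pick ?K i = pick I i"
      show ?thesis
        using cases[OF ij(2)]
        by (elim disjE exE conjE)
          (use i carr B D in \<open>simp_all add: pI pJ submatrix_index_subset[OF B I I]
            submatrix_index_subset[OF X I J] trans_less_add1\<close>)
    next
      fix i' assume i: "i = card I + i'" "i' < card J" "pick ?K i = n + pick J i'"
      show ?thesis
        using cases[OF ij(2)]
        by (elim disjE exE conjE)
          (use i carr B D in \<open>simp_all add: pI pJ submatrix_index_subset[OF D J J]
            trans_less_add1\<close>)
    qed
    then show "submatrix ?M ?K ?K $$ (i, j) = ?N $$ (i, j)"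
      using submatrix_index_subset[OF M K K] ij cK by simp
  qed (use N submatrix_carrier_subset[OF M K K] cK in auto)
qed

text \<open>The 0 by 0 determinant is 1. Admitting the empty set lets either half of a split index
  set be empty without a case distinction.\<close>

lemma P_matrix_iff:
  assumes "M \<in> carrier_mat n n"
  shows "P_matrix M \<longleftrightarrow> (\<forall>I \<subseteq> {..<n}. det (submatrix M I I) > 0)"
proof -
  have "det (submatrix M {} {}) = 1"
    using submatrix_carrier_subset[OF assms, of "{}" "{}"] by simp
  then have "det (submatrix M {} {}) > 0" by simp
  moreover have "dim_row M = n" "square_mat M" using assms by auto
  ultimately show ?thesis unfolding P_matrix_def by metis
qed

lemma P_matrix_four_block_mat_iff:
  assumes B: "B \<in> carrier_mat n n" and X: "X \<in> carrier_mat n m" and D: "D \<in> carrier_mat m m"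
  shows "P_matrix (four_block_mat B X (0\<^sub>m m n) D) \<longleftrightarrow> P_matrix B \<and> P_matrix D"
    (is "P_matrix ?M \<longleftrightarrow> _")
proof -
  have M: "?M \<in> carrier_mat (n + m) (n + m)" using B D by simp
  have det: "det (submatrix ?M (I \<union> (+) n ` J) (I \<union> (+) n ` J)) =
      det (submatrix B I I) * det (submatrix D J J)"
    if I: "I \<subseteq> {..<n}" and J: "J \<subseteq> {..<m}" for I J
    unfolding submatrix_four_block_mat[OF B X D I J]
    by (rule det_four_block_mat_lower_left_zero
        [OF submatrix_carrier_subset[OF B I I] submatrix_carrier_subset[OF X I J] refl
          submatrix_carrier_subset[OF D J J]])
  have one: "det (submatrix B {} {}) = 1" "det (submatrix D {} {}) = 1"
    using submatrix_carrier_subset[OF B, of "{}" "{}"] submatrix_carrier_subset[OF D, of "{}" "{}"]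
    by simp_all
  show ?thesis
  proof
    assume "P_matrix ?M"
    then have pos: "det (submatrix B I I) * det (submatrix D J J) > 0"
      if "I \<subseteq> {..<n}" "J \<subseteq> {..<m}" for I J
    proof -
      have "I \<union> (+) n ` J \<subseteq> {..<n + m}" using that by auto
      then show ?thesis using \<open>P_matrix ?M\<close> det[OF that] unfolding P_matrix_iff[OF M] by metis
    qed
    show "P_matrix B \<and> P_matrix D"
      unfolding P_matrix_iff[OF B] P_matrix_iff[OF D]
      \<comment> \<open>With one of the two sets empty its factor is 1, which isolates a minor of
        the other block.\<close>
      using pos[of _ "{}"] pos[of "{}"] one by simp
  next
    assume P: "P_matrix B \<and> P_matrix D"
    show "P_matrix ?M"
      unfolding P_matrix_iff[OF M]
    proof (intro allI impI)
      fix K :: "nat set" assume K: "K \<subseteq> {..<n + m}"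
      \<comment> \<open>Cut \<open>K\<close> at n and shift the upper part down by n; thus every
        index set has the form covered by the product formula \<open>det\<close>.\<close>
      define I where "I = K \<inter> {..<n}"
      define J where "J = {j. n + j \<in> K}"
      have I: "I \<subseteq> {..<n}" and J: "J \<subseteq> {..<m}" using K by (auto simp: I_def J_def)
      have "k \<in> (+) n ` J" if "k \<in> K" "\<not> k < n" for k
        using that by (intro image_eqI[of _ _ "k - n"]) (auto simp: J_def)
      then have "K = I \<union> (+) n ` J" by (auto simp: I_def J_def)
      then show "det (submatrix ?M K K) > 0"
        using det[OF I J] P I J unfolding P_matrix_iff[OF B] P_matrix_iff[OF D] by simp
    qed
  qed
qed

text \<open>Block multiplication keeps the zero corner and multiplies the diagonal blocks
  separately. The upper right block is the sum of \<open>B^i C D^(k-1-i)\<close> over i < k; only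
  its dimensions are recorded.\<close>

lemma pow_four_block_mat_upper:
  fixes B :: "'a :: comm_semiring_1 mat"
  assumes B: "B \<in> carrier_mat n n" and C: "C \<in> carrier_mat n m" and D: "D \<in> carrier_mat m m"
  shows "\<exists>X \<in> carrier_mat n m.
    four_block_mat B C (0\<^sub>m m n) D ^\<^sub>m k = four_block_mat (B ^\<^sub>m k) X (0\<^sub>m m n) (D ^\<^sub>m k)"
proof (induction k)
  case 0
  then show ?case using B D by (intro bexI[of _ "0\<^sub>m n m"]) auto
next
  case (Suc k)
  then obtain X where X: "X \<in> carrier_mat n m"
    and eq: "four_block_mat B C (0\<^sub>m m n) D ^\<^sub>m k = four_block_mat (B ^\<^sub>m k) X (0\<^sub>m m n) (D ^\<^sub>m k)"
    by blast
  have "four_block_mat B C (0\<^sub>m m n) D ^\<^sub>m Suc k =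
      four_block_mat (B ^\<^sub>m k) X (0\<^sub>m m n) (D ^\<^sub>m k) * four_block_mat B C (0\<^sub>m m n) D"
    by (simp add: eq)
  also have "\<dots> = four_block_mat (B ^\<^sub>m Suc k) (B ^\<^sub>m k * C + X * D) (0\<^sub>m m n) (D ^\<^sub>m Suc k)"
    unfolding mult_four_block_mat[OF pow_carrier_mat[OF B] X zero_carrier_mat pow_carrier_mat[OF D]
        B C zero_carrier_mat D]
    using B C D X by (intro cong_four_block_mat) auto
  finally show ?case using B C D X by (intro bexI[of _ "B ^\<^sub>m k * C + X * D"]) auto
qed

text \<open>The entrywise series agree term by term on the diagonal blocks, and have only zero terms
  in the lower left block.\<close>

lemma mat_exp_four_block_mat:
  assumes B: "B \<in> carrier_mat n n" and C: "C \<in> carrier_mat n m" and D: "D \<in> carrier_mat m m"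
  shows "\<exists>X \<in> carrier_mat n m.
    mat_exp (four_block_mat B C (0\<^sub>m m n) D) = four_block_mat (mat_exp B) X (0\<^sub>m m n) (mat_exp D)"
proof -
  let ?A = "four_block_mat B C (0\<^sub>m m n) D"
  \<comment> \<open>The corner is read off from the exponential itself, so that block agrees by
    construction.\<close>
  define X where "X = mat n m (\<lambda>(i, j). mat_exp ?A $$ (i, n + j))"
  have diag1: "(?A ^\<^sub>m k) $$ (i, j) = (B ^\<^sub>m k) $$ (i, j)" if "i < n" "j < n" for i j k
    using pow_four_block_mat_upper[OF B C D, of k] that B D by auto
  have diag2: "(?A ^\<^sub>m k) $$ (i, j) = (D ^\<^sub>m k) $$ (i - n, j - n)"
    if "\<not> i < n" "\<not> j < n" "i < n + m" "j < n + m" for i j k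
    using pow_four_block_mat_upper[OF B C D, of k] that B D by auto
  have low: "(?A ^\<^sub>m k) $$ (i, j) = 0" if "\<not> i < n" "j < n" "i < n + m" for i j k
    using pow_four_block_mat_upper[OF B C D, of k] that B D by auto
  have "mat_exp ?A = four_block_mat (mat_exp B) X (0\<^sub>m m n) (mat_exp D)"
    by (rule eq_matI) (use B C D in \<open>auto simp: mat_exp_def X_def diag1 diag2 low\<close>)
  then show ?thesis by (intro bexI[of _ X]) (auto simp: X_def)
qed

theorem theorem8:
  fixes n m :: nat and A B C D :: "real mat"
  assumes "B \<in> carrier_mat n n"
    and "C \<in> carrier_mat n m"
    and "D \<in> carrier_mat m m"
    and "A = four_block_mat B C (0\<^sub>m m n) D"
  shows "EP_matrix A \<longleftrightarrow> EP_matrix B \<and> EP_matrix D"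
proof -
  note B = assms(1) and C = assms(2) and D = assms(3)
  \<comment> \<open>The equivalence holds for each t separately, so the quantifier over t \<ge> 0
    distributes over the conjunction.\<close>
  have "P_matrix (mat_exp (t \<cdot>\<^sub>m A)) \<longleftrightarrow> P_matrix (mat_exp (t \<cdot>\<^sub>m B)) \<and> P_matrix (mat_exp (t \<cdot>\<^sub>m D))"
    for t
  proof -
    have "t \<cdot>\<^sub>m A = four_block_mat (t \<cdot>\<^sub>m B) (t \<cdot>\<^sub>m C) (0\<^sub>m m n) (t \<cdot>\<^sub>m D)"
      using smult_four_block_mat[OF B C zero_carrier_mat D] by (simp add: assms(4))
    then obtain X where X: "X \<in> carrier_mat n m"
      and eq: "mat_exp (t \<cdot>\<^sub>m A) =
        four_block_mat (mat_exp (t \<cdot>\<^sub>m B)) X (0\<^sub>m m n) (mat_exp (t \<cdot>\<^sub>m D))"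
      using mat_exp_four_block_mat[of "t \<cdot>\<^sub>m B" n "t \<cdot>\<^sub>m C" m "t \<cdot>\<^sub>m D"] B C D by auto
    show ?thesis
      unfolding eq using B D by (intro P_matrix_four_block_mat_iff X) (auto simp: mat_exp_def)
  qed
  moreover have "square_mat A" "square_mat B" "square_mat D" using assms by auto
  ultimately show ?thesis unfolding EP_matrix_def by blast
qed

end
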